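(* There is a polynomial time reduction that reduces the orbit closure problem with witness for matrix invariants to the orbit closure problem with witness for matrix semi-invariants.
   Context: $K$ is an algebraically closed field; $n,m$ are positive integers; $\mathrm{Mat}_{n,n}$ is the space of $n\times n$ matrices over $K$. For a group $G$ acting on $V$, write $v\sim w$ if the Zariski closures of the orbits of $v$ and $w$ intersect. An algorithm for the orbit closure problem with witness is an algorithm that decides whether $v\sim w$ for any two points $v,w\in V$ and, if $v\not\sim w$, provides a witness $f\in K[V]^G$ with $f(v)\ne f(w)$. "Matrix invariants" refers to the simultaneous conjugation action of $\mathrm{GL}_n$ on $\mathrm{Mat}_{n,n}^m$, $g\cdot(X_i)_i=(gX_ig^{-1})_i$. "Matrix semi-invariants" refers to the left-right action of $\mathrm{SL}_n\times\mathrm{SL}_n$ on $\mathrm{Mat}_{n,n}^m$, $(P,Q)\cdot(X_i)_i=(PX_iQ^{-1})_i$. A polynomial time reduction from the first problem to the second is an algorithm solving the first problem that runs in time polynomial in $n$ and $m$ and may call an algorithm for the second problem on instances of polynomially bounded size; running time is in the unit cost arithmetic model, in which each field operation or equality test costs one unit. Witnesses are given by explicit descriptions as polynomial functions (for instance arithmetic circuits). *)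

theory Defs
  imports
    "HOL-Algebra.Group_Action"
    "Jordan_Normal_Form.Determinant"
begin

section \<open>Matrix tuples, polynomial functions and orbit closures\<close>

definition mat_tuples :: "nat \<Rightarrow> nat \<Rightarrow> 'a mat list set" where
  "mat_tuples n m = {X. length X = m \<and> set X \<subseteq> carrier_mat n n}"

text \<open>
  The coordinate ring of the space of tuples.  Over an infinite field a polynomial and the
  function it induces determine each other, so polynomials are represented by functions.
\<close>

inductive_set poly_funs :: "nat \<Rightarrow> nat \<Rightarrow> ('a::field mat list \<Rightarrow> 'a) set" for n m :: nat where
  const: "(\<lambda>_. c) \<in> poly_funs n m"
| coord: "k < m \<Longrightarrow> i < n \<Longrightarrow> j < n \<Longrightarrow> (\<lambda>X. (X ! k) $$ (i, j)) \<in> poly_funs n m"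
| add: "f \<in> poly_funs n m \<Longrightarrow> g \<in> poly_funs n m \<Longrightarrow> (\<lambda>X. f X + g X) \<in> poly_funs n m"
| mult: "f \<in> poly_funs n m \<Longrightarrow> g \<in> poly_funs n m \<Longrightarrow> (\<lambda>X. f X * g X) \<in> poly_funs n m"

definition zariski_closure :: "nat \<Rightarrow> nat \<Rightarrow> 'a::field mat list set \<Rightarrow> 'a mat list set" where
  "zariski_closure n m S =
     {x \<in> mat_tuples n m. \<forall>f \<in> poly_funs n m. (\<forall>y\<in>S. f y = 0) \<longrightarrow> f x = 0}"

definition orbit_closure_equiv ::
  "nat \<Rightarrow> nat \<Rightarrow> ('g, 'b) monoid_scheme \<Rightarrow> ('g \<Rightarrow> 'a::field mat list \<Rightarrow> 'a mat list)
    \<Rightarrow> 'a mat list \<Rightarrow> 'a mat list \<Rightarrow> bool" where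
  "orbit_closure_equiv n m G \<phi> v w \<longleftrightarrow>
     zariski_closure n m (orbit G \<phi> v) \<inter> zariski_closure n m (orbit G \<phi> w) \<noteq> {}"

definition invariants ::
  "nat \<Rightarrow> nat \<Rightarrow> ('g, 'b) monoid_scheme \<Rightarrow> ('g \<Rightarrow> 'a::field mat list \<Rightarrow> 'a mat list)
    \<Rightarrow> ('a mat list \<Rightarrow> 'a) set" where
  "invariants n m G \<phi> =
     {f \<in> poly_funs n m. \<forall>g \<in> carrier G. \<forall>x \<in> mat_tuples n m. f (\<phi> g x) = f x}"

definition GL :: "nat \<Rightarrow> 'a::field mat monoid" where
  "GL n = units_of (ring_mat TYPE('a) n ())"

definition SL :: "nat \<Rightarrow> 'a::field mat monoid" where
  "SL n = (GL n)\<lparr>carrier := {g \<in> carrier (GL n). det g = 1}\<rparr>"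

definition conj_action :: "nat \<Rightarrow> 'a::field mat \<Rightarrow> 'a mat list \<Rightarrow> 'a mat list" where
  "conj_action n g X = map (\<lambda>A. g * A * inv\<^bsub>GL n\<^esub> g) X"

definition left_right_action :: "nat \<Rightarrow> 'a::field mat \<times> 'a mat \<Rightarrow> 'a mat list \<Rightarrow> 'a mat list" where
  "left_right_action n = (\<lambda>(P, Q) X. map (\<lambda>A. P * A * inv\<^bsub>SL n\<^esub> Q) X)"

section \<open>Arithmetic circuits and the orbit closure problem with witness\<close>

datatype 'a gate = Const 'a | Add nat nat | Mul nat nat

type_synonym 'a circuit = "'a gate list"

text \<open>
  A circuit is a straight-line program.  The list of available values consists of the inputs
  followed by the values of the gates evaluated so far; operands of gates are indices into this
  list, and the output is its last entry.
\<close>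

fun gate_value :: "'a::field list \<Rightarrow> 'a gate \<Rightarrow> 'a" where
  "gate_value vs (Const c) = c"
| "gate_value vs (Add i j) = vs ! i + vs ! j"
| "gate_value vs (Mul i j) = vs ! i * vs ! j"

fun gate_ok :: "nat \<Rightarrow> 'a gate \<Rightarrow> bool" where
  "gate_ok l (Const c) \<longleftrightarrow> True"
| "gate_ok l (Add i j) \<longleftrightarrow> i < l \<and> j < l"
| "gate_ok l (Mul i j) \<longleftrightarrow> i < l \<and> j < l"

definition circuit_ok :: "nat \<Rightarrow> 'a circuit \<Rightarrow> bool" where
  "circuit_ok N c \<longleftrightarrow> (\<forall>k < length c. gate_ok (N + k) (c ! k))"

definition circuit_value :: "'a::field circuit \<Rightarrow> 'a list \<Rightarrow> 'a" where
  "circuit_value c xs = last (foldl (\<lambda>vs g. vs @ [gate_value vs g]) xs c)"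

text \<open>Matrix by matrix, each matrix row by row.\<close>

definition entries :: "'a mat list \<Rightarrow> 'a list" where
  "entries X = concat (concat (map mat_to_list X))"

definition computes ::
  "nat \<Rightarrow> nat \<Rightarrow> 'a::field circuit \<Rightarrow> ('a mat list \<Rightarrow> 'a) \<Rightarrow> bool" where
  "computes n m c f \<longleftrightarrow>
     circuit_ok (m * n * n) c \<and> (\<forall>x \<in> mat_tuples n m. circuit_value c (entries x) = f x)"

text \<open>
  A problem relates the parameters n and m and two points to the answers that are correct for them.
  The answer None means that the orbit closures intersect; Some c means that they do not, with
  the circuit c describing the witness.
\<close>

type_synonym 'a problem =
  "nat \<Rightarrow> nat \<Rightarrow> 'a mat list \<Rightarrow> 'a mat list \<Rightarrow> 'a circuit option \<Rightarrow> bool"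

definition orbit_closure_problem ::
  "(nat \<Rightarrow> ('g, 'b) monoid_scheme) \<Rightarrow> (nat \<Rightarrow> 'g \<Rightarrow> 'a::field mat list \<Rightarrow> 'a mat list)
    \<Rightarrow> 'a problem" where
  "orbit_closure_problem G \<phi> n m v w ans \<longleftrightarrow>
     (case ans of
        None \<Rightarrow> orbit_closure_equiv n m (G n) (\<phi> n) v w
      | Some c \<Rightarrow> \<not> orbit_closure_equiv n m (G n) (\<phi> n) v w \<and>
          (\<exists>f \<in> invariants n m (G n) (\<phi> n). computes n m c f \<and> f v \<noteq> f w))"

definition matrix_invariants_problem :: "'a::field problem" where
  "matrix_invariants_problem = orbit_closure_problem GL conj_action"

definition matrix_semi_invariants_problem :: "'a::field problem" where
  "matrix_semi_invariants_problem = orbit_closure_problem (\<lambda>n. SL n \<times>\<times> SL n) left_right_action"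

section \<open>Programs with subroutine calls in the unit cost arithmetic model\<close>

text \<open>
  Programs are while programs over a random access memory with index registers, arrays of indices
  and arrays of field elements, all addressed through index registers.  Index arithmetic is
  restricted to constants, copying, successor and predecessor, so that indices cannot grow faster
  than the running time.  Every instruction and every test costs one unit; the cost
  of a call of the solver is given below.  Division by zero yields zero, as usual in HOL.
\<close>

record 'a state =
  reg :: "nat \<Rightarrow> nat"
  iarr :: "nat \<Rightarrow> nat \<Rightarrow> nat"
  farr :: "nat \<Rightarrow> nat \<Rightarrow> 'a"

datatype arith_op = Plus | Minus | Times | Divide

fun arith :: "arith_op \<Rightarrow> 'a::field \<Rightarrow> 'a \<Rightarrow> 'a" where
  "arith Plus x y = x + y"
| "arith Minus x y = x - y"
| "arith Times x y = x * y"
| "arith Divide x y = x / y"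

text \<open>
  The cell (a, r) is the entry of array a at the index held by register r.  The array number a
  is part of the program text.
\<close>

type_synonym cell = "nat \<times> nat"

datatype 'a instr =
    SetI nat nat
  | CopyI nat nat
  | IncI nat
  | DecI nat
  | LoadI nat cell
  | StoreI cell nat
  | SetF cell 'a
  | CopyF cell cell
  | OpF arith_op cell cell cell

datatype test = LessI nat nat | EqI nat nat | EqF cell cell

datatype 'a prog =
    Skip
  | Instr "'a instr"
  | Seq "'a prog" "'a prog"
  | Cond test "'a prog" "'a prog"
  | While test "'a prog"
  | Call

definition ival :: "'a state \<Rightarrow> cell \<Rightarrow> nat" where
  "ival s p = iarr s (fst p) (reg s (snd p))"

definition fval :: "'a state \<Rightarrow> cell \<Rightarrow> 'a" where
  "fval s p = farr s (fst p) (reg s (snd p))"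

definition set_reg :: "nat \<Rightarrow> nat \<Rightarrow> 'a state \<Rightarrow> 'a state" where
  "set_reg r x s = s\<lparr>reg := (reg s)(r := x)\<rparr>"

definition set_icell :: "cell \<Rightarrow> nat \<Rightarrow> 'a state \<Rightarrow> 'a state" where
  "set_icell p x s =
     s\<lparr>iarr := (iarr s)(fst p := (iarr s (fst p))(reg s (snd p) := x))\<rparr>"

definition set_fcell :: "cell \<Rightarrow> 'a \<Rightarrow> 'a state \<Rightarrow> 'a state" where
  "set_fcell p x s =
     s\<lparr>farr := (farr s)(fst p := (farr s (fst p))(reg s (snd p) := x))\<rparr>"

fun exec_instr :: "'a::field instr \<Rightarrow> 'a state \<Rightarrow> 'a state" where
  "exec_instr (SetI r x) s = set_reg r x s"
| "exec_instr (CopyI r q) s = set_reg r (reg s q) s"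
| "exec_instr (IncI r) s = set_reg r (reg s r + 1) s"
| "exec_instr (DecI r) s = set_reg r (reg s r - 1) s"
| "exec_instr (LoadI r p) s = set_reg r (ival s p) s"
| "exec_instr (StoreI p r) s = set_icell p (reg s r) s"
| "exec_instr (SetF p x) s = set_fcell p x s"
| "exec_instr (CopyF p q) s = set_fcell p (fval s q) s"
| "exec_instr (OpF f p q q') s = set_fcell p (arith f (fval s q) (fval s q')) s"

fun holds :: "test \<Rightarrow> 'a state \<Rightarrow> bool" where
  "holds (LessI r q) s \<longleftrightarrow> reg s r < reg s q"
| "holds (EqI r q) s \<longleftrightarrow> reg s r = reg s q"
| "holds (EqF p q) s \<longleftrightarrow> fval s p = fval s q"

text \<open>
  Programs and the solver they call share one calling convention.  On entry, registers 0 and 1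
  hold n and m, the entries of the two points are the first m * n * n entries of the field arrays 0 and 1, and
  register 2 holds the address at which the witness is to be stored.  On exit, register 0
  holds 1 if the orbit closures intersect and 0 otherwise; in the latter case, register 1 holds
  the number of gates of the witness, and its gates are stored from the given address on: the kind
  of a gate in index array 0, its operands in index arrays 1 and 2, its constant in field array 2.
\<close>

type_synonym 'a solver = "nat \<Rightarrow> nat \<Rightarrow> 'a list \<Rightarrow> 'a list \<Rightarrow> 'a circuit option"

fun gate_kind :: "'a gate \<Rightarrow> nat" where
  "gate_kind (Const c) = 0"
| "gate_kind (Add i j) = 1"
| "gate_kind (Mul i j) = 2"

fun gate_left :: "'a gate \<Rightarrow> nat" where
  "gate_left (Const c) = 0"
| "gate_left (Add i j) = i"
| "gate_left (Mul i j) = i"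

fun gate_right :: "'a gate \<Rightarrow> nat" where
  "gate_right (Const c) = 0"
| "gate_right (Add i j) = j"
| "gate_right (Mul i j) = j"

fun gate_const :: "'a::field gate \<Rightarrow> 'a" where
  "gate_const (Const c) = c"
| "gate_const (Add i j) = 0"
| "gate_const (Mul i j) = 0"

definition overwrite :: "nat \<Rightarrow> 'b list \<Rightarrow> (nat \<Rightarrow> 'b) \<Rightarrow> nat \<Rightarrow> 'b" where
  "overwrite p xs h k = (if p \<le> k \<and> k < p + length xs then xs ! (k - p) else h k)"

definition solver_answer :: "'a solver \<Rightarrow> 'a state \<Rightarrow> 'a circuit option" where
  "solver_answer alg s =
     (let n = reg s 0; m = reg s 1 in
      alg n m (map (farr s 0) [0..<m * n * n]) (map (farr s 1) [0..<m * n * n]))"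

definition store_answer :: "'a::field circuit option \<Rightarrow> 'a state \<Rightarrow> 'a state" where
  "store_answer ans s =
     (case ans of
        None \<Rightarrow> s\<lparr>reg := (reg s)(0 := 1)\<rparr>
      | Some c \<Rightarrow>
          s\<lparr>reg := (reg s)(0 := 0, 1 := length c),
            iarr := (iarr s)
              (0 := overwrite (reg s 2) (map gate_kind c) (iarr s 0),
               1 := overwrite (reg s 2) (map gate_left c) (iarr s 1),
               2 := overwrite (reg s 2) (map gate_right c) (iarr s 2)),
            farr := (farr s)(2 := overwrite (reg s 2) (map gate_const c) (farr s 2))\<rparr>)"

text \<open>
  A call is charged one unit plus the size of the instance, so that a time bound also
  bounds the number of calls and the sizes of the instances.
\<close>

definition call_cost :: "'a state \<Rightarrow> nat" where
  "call_cost s = (let n = reg s 0; m = reg s 1 in 1 + n + m + 2 * (m * n * n))"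

inductive exec :: "'a::field solver \<Rightarrow> 'a prog \<Rightarrow> 'a state \<Rightarrow> nat \<Rightarrow> 'a state \<Rightarrow> bool"
  for alg :: "'a solver" where
  Skip: "exec alg Skip s 0 s"
| Instr: "exec alg (Instr i) s 1 (exec_instr i s)"
| Seq: "exec alg p s t s' \<Longrightarrow> exec alg q s' t' s'' \<Longrightarrow> exec alg (Seq p q) s (t + t') s''"
| CondT: "holds b s \<Longrightarrow> exec alg p s t s' \<Longrightarrow> exec alg (Cond b p q) s (1 + t) s'"
| CondF: "\<not> holds b s \<Longrightarrow> exec alg q s t s' \<Longrightarrow> exec alg (Cond b p q) s (1 + t) s'"
| WhileT: "holds b s \<Longrightarrow> exec alg p s t s' \<Longrightarrow> exec alg (While b p) s' t' s''
    \<Longrightarrow> exec alg (While b p) s (1 + t + t') s''"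
| WhileF: "\<not> holds b s \<Longrightarrow> exec alg (While b p) s 1 s"
| Call: "exec alg Call s (call_cost s) (store_answer (solver_answer alg s) s)"

inductive_cases exec_SkipE: "exec alg Skip s t s'"
inductive_cases exec_InstrE: "exec alg (Instr i) s t s'"
inductive_cases exec_SeqE: "exec alg (Seq p q) s t s'"
inductive_cases exec_CondE: "exec alg (Cond b p q) s t s'"
inductive_cases exec_WhileE: "exec alg (While b p) s t s'"
inductive_cases exec_CallE: "exec alg Call s t s'"

lemma exec_deterministic:
  "exec alg p s t s' \<Longrightarrow> exec alg p s u s'' \<Longrightarrow> t = u \<and> s' = s''"
proof (induction arbitrary: u s'' rule: exec.induct)
  case (Skip s)
  from Skip.prems show ?case by (rule exec_SkipE) (intro conjI; rule sym; assumption)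
next
  case (Instr i s)
  from Instr.prems show ?case by (rule exec_InstrE) (simp only: One_nat_def simp_thms)
next
  case (Seq p s t s' q t' s0)
  from Seq.prems show ?case
  proof (rule exec_SeqE)
    fix x s1 y
    assume u: "u = x + y" and x: "exec alg p s x s1" and y: "exec alg q s1 y s''"
    from Seq.IH(1)[OF x] have eq: "t = x" "s' = s1" by (rule conjunct1, rule conjunct2)
    from Seq.IH(2)[unfolded eq(2), OF y] u eq(1) show ?thesis by presburger
  qed
next
  case (CondT b s p t s' q)
  from CondT.prems obtain x where u: "u = Suc x" and x: "exec alg p s x s''"
    by (rule exec_CondE) (blast intro: CondT.hyps(1) elim: notE[OF _ CondT.hyps(1)])+
  from CondT.IH[OF x] u show ?case by presburger
next
  case (CondF b s q t s' p)
  from CondF.prems obtain x where u: "u = Suc x" and x: "exec alg q s x s''"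
    by (rule exec_CondE) (blast elim: notE[OF CondF.hyps(1)])+
  from CondF.IH[OF x] u show ?case by presburger
next
  case (WhileT b s p t s' t' s0)
  from WhileT.prems show ?case
  proof (rule exec_WhileE)
    fix x s1 y
    assume u: "u = Suc (x + y)" and x: "exec alg p s x s1" and y: "exec alg (While b p) s1 y s''"
    from WhileT.IH(1)[OF x] have eq: "t = x" "s' = s1" by (rule conjunct1, rule conjunct2)
    from WhileT.IH(2)[unfolded eq(2), OF y] u eq(1) show ?thesis by presburger
  next
    assume "\<not> holds b s"
    with WhileT.hyps(1) show ?thesis by (rule notE[rotated])
  qed
next
  case (WhileF b s p)
  from WhileF.prems show ?case
  proof (rule exec_WhileE)
    assume "holds b s"
    with WhileF.hyps(1) show ?thesis by (rule notE)
  next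
    assume "u = Suc 0" "s'' = s"
    then show ?thesis by presburger
  qed
next
  case (Call s)
  from Call.prems show ?case by (rule exec_CallE) (intro conjI; rule sym; assumption)
qed

definition initial_state :: "nat \<Rightarrow> nat \<Rightarrow> 'a::field mat list \<Rightarrow> 'a mat list \<Rightarrow> 'a state" where
  "initial_state n m v w =
     \<lparr>reg = (\<lambda>_. 0)(0 := n, 1 := m),
      iarr = (\<lambda>_ _. 0),
      farr = (\<lambda>_ _. 0)(0 := overwrite 0 (entries v) (\<lambda>_. 0),
                       1 := overwrite 0 (entries w) (\<lambda>_. 0))\<rparr>"

definition read_gate :: "'a state \<Rightarrow> nat \<Rightarrow> 'a gate" where
  "read_gate s k =
     (if iarr s 0 k = 0 then Const (farr s 2 k)
      else if iarr s 0 k = 1 then Add (iarr s 1 k) (iarr s 2 k)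
      else Mul (iarr s 1 k) (iarr s 2 k))"

definition read_answer :: "'a state \<Rightarrow> 'a circuit option" where
  "read_answer s = (if reg s 0 = 1 then None else Some (map (read_gate s) [0..<reg s 1]))"

section \<open>Polynomial time reductions\<close>

definition solves :: "'a::field solver \<Rightarrow> 'a problem \<Rightarrow> bool" where
  "solves alg A \<longleftrightarrow>
     (\<forall>n m. n > 0 \<longrightarrow> m > 0 \<longrightarrow> (\<forall>v \<in> mat_tuples n m. \<forall>w \<in> mat_tuples n m.
        A n m v w (alg n m (entries v) (entries w))))"

text \<open>
  The same program and the same time bound have to work for all parameters and for all solvers
  solving the second problem.
\<close>

definition poly_time_reduction :: "'a::field prog \<Rightarrow> 'a problem \<Rightarrow> 'a problem \<Rightarrow> bool" where
  "poly_time_reduction red A B \<longleftrightarrow>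
     (\<exists>p :: nat poly. \<forall>alg. solves alg B \<longrightarrow>
        (\<forall>n m. n > 0 \<longrightarrow> m > 0 \<longrightarrow> (\<forall>v \<in> mat_tuples n m. \<forall>w \<in> mat_tuples n m.
           \<exists>t s. exec alg red (initial_state n m v w) t s \<and> t \<le> poly p (n + m) \<and>
             A n m v w (read_answer s))))"

end

theory Submission
  imports Defs
begin

text \<open>
  Appending the identity matrix to a tuple turns simultaneous conjugation into the left-right
  action: $(P, Q)$ fixes the last entry $1$ of $(X, 1)$ exactly if $P = Q$, and then acts on $X$ by
  conjugation.  The reduction asks the solver for semi-invariants about $(v, 1)$ and $(w, 1)$.

  The two questions are equivalent because points in the intersection of two orbit closures can
  be carried from one side to the other by polynomial maps that send orbits into orbits.
  In one direction the map is $X \mapsto (X, 1)$; it sends a conjugation orbit into a left-right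
  orbit, since over an algebraically closed field every conjugation can be performed by a matrix
  of determinant one (\<open>closure_append_one\<close>).  In the other direction it is
  $(Z, A) \mapsto \mathrm{adj}(A)\, Z$.  On the orbit of $(v, 1)$ the last entry is
  $A = P Q^{-1}$, whose adjugate is $Q P^{-1}$ as its determinant is one, so the point
  $(P v Q^{-1}, P Q^{-1})$ is sent to $Q v Q^{-1}$ (\<open>closure_dehomogenize\<close>).  The adjugate
  is polynomial in $A$, unlike the inverse, so that polynomials can be pulled back along this map.
  Finally, a separating semi-invariant $f$ yields the separating invariant $X \mapsto f(X, 1)$.

  A circuit for $f$ becomes a circuit for $X \mapsto f(X, 1)$ by putting $n^2$ constant gates, the
  entries of the identity matrix, in front of it.  As the identity is the last matrix of the tuple,
  these gates take the places in the list of values that the inputs of the last matrix had.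
  Every operand index of the old circuit therefore stays valid, and the circuit, whose length is
  not bounded, need not be touched (\<open>extend_answer_correct\<close>).

  The program thus only has to write the ones of the identity matrix into the two
  points and into the array of constants, to have the solver store its circuit at address $n^2$,
  and to add $n^2$ to the number of gates (\<open>runs_reduction\<close>).  The arrays of the initial
  state are zero elsewhere, and zero is also the code of a constant gate, so nothing else
  needs to be written.
\<close>

section \<open>Polynomial functions\<close>

lemma poly_funs_sum:
  assumes "\<And>a. a \<in> A \<Longrightarrow> f a \<in> poly_funs n m"
  shows "(\<lambda>X. \<Sum>a\<in>A. f a X) \<in> poly_funs n m"
  using assms
  by (induction A rule: infinite_finite_induct) (auto intro: poly_funs.intros)

lemma poly_funs_prod:
  assumes "\<And>a. a \<in> A \<Longrightarrow> f a \<in> poly_funs n m"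
  shows "(\<lambda>X. \<Prod>a\<in>A. f a X) \<in> poly_funs n m"
  using assms
  by (induction A rule: infinite_finite_induct) (auto intro: poly_funs.intros)

lemma poly_funs_det:
  assumes "\<And>i j. i < d \<Longrightarrow> j < d \<Longrightarrow> e i j \<in> poly_funs n m"
  shows "(\<lambda>X. det (mat d d (\<lambda>(i, j). e i j X))) \<in> poly_funs n m"
proof -
  have "(\<lambda>X. \<Sum>p\<in>{p. p permutes {0..<d}}. signof p * (\<Prod>i\<in>{0..<d}. e i (p i) X))
      \<in> poly_funs n m"
    by (intro poly_funs_sum poly_funs.mult poly_funs.const poly_funs_prod assms)
      (auto dest: permutes_in_image)
  moreover have "det (mat d d (\<lambda>(i, j). e i j X)) =
      (\<Sum>p\<in>{p. p permutes {0..<d}}. signof p * (\<Prod>i\<in>{0..<d}. e i (p i) X))" for X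
  proof -
    have "(\<Prod>i\<in>{0..<d}. mat d d (\<lambda>(i, j). e i j X) $$ (i, p i)) = (\<Prod>i\<in>{0..<d}. e i (p i) X)"
      if "p permutes {0..<d}" for p
      using permutes_in_image[OF that] by (intro prod.cong) auto
    then show ?thesis
      by (simp add: det_def'[of _ d])
  qed
  ultimately show ?thesis by presburger
qed

text \<open>
  Polynomial functions refer to lists of any length and matrices of any dimension, not only to the
  tuples of the space.  The substituted tuple is rebuilt entry by entry so that the result is
  literally a polynomial function, also outside of the space.
\<close>

lemma poly_funs_subst:
  assumes "f \<in> poly_funs n l"
    and "\<And>k i j. k < l \<Longrightarrow> i < n \<Longrightarrow> j < n \<Longrightarrow> e k i j \<in> poly_funs n m"
  shows "(\<lambda>X. f (map (\<lambda>k. mat n n (\<lambda>(i, j). e k i j X)) [0..<l])) \<in> poly_funs n m"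
  using assms(1)
proof induction
  case (coord k i j)
  then show ?case using assms(2)[of k i j] by simp
qed (auto intro: poly_funs.intros)

lemma mat_tuplesD:
  assumes "X \<in> mat_tuples n m"
  shows "length X = m" "\<And>k. k < m \<Longrightarrow> X ! k \<in> carrier_mat n n"
  using assms by (auto simp: mat_tuples_def)

lemma append_mat_tuples:
  assumes "X \<in> mat_tuples n m" "A \<in> carrier_mat n n"
  shows "X @ [A] \<in> mat_tuples n (Suc m)"
  using assms by (auto simp: mat_tuples_def)

lemma poly_funs_append_one:
  assumes "f \<in> poly_funs n (Suc m)"
  obtains g where "g \<in> poly_funs n m" "\<And>X. X \<in> mat_tuples n m \<Longrightarrow> g X = f (X @ [1\<^sub>m n])"
proof
  let ?e = "\<lambda>k i j X. if k < m then (X ! k) $$ (i, j) else 1\<^sub>m n $$ (i, j)"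
  let ?g = "\<lambda>X. f (map (\<lambda>k. mat n n (\<lambda>(i, j). ?e k i j X)) [0..<Suc m])"
  have "?e k i j \<in> poly_funs n m" if "i < n" "j < n" for k i j
    using that by (cases "k < m") (auto intro: poly_funs.intros)
  then show "?g \<in> poly_funs n m"
    by (intro poly_funs_subst[OF assms])
  fix X :: "'a mat list" assume X: "X \<in> mat_tuples n m"
  have "map (\<lambda>k. mat n n (\<lambda>(i, j). ?e k i j X)) [0..<Suc m] = X @ [1\<^sub>m n]"
    using mat_tuplesD(1)[OF X] carrier_matD[OF mat_tuplesD(2)[OF X]]
    by (intro nth_equalityI) (auto simp: nth_append less_Suc_eq intro!: eq_matI)
  then show "?g X = f (X @ [1\<^sub>m n])" by simp
qed

text \<open>
  If the last entry has determinant one, this multiplies the others by its inverse; the adjugate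
  makes it a polynomial map that is defined everywhere.
\<close>

definition dehomogenize :: "'a::field mat list \<Rightarrow> 'a mat list" where
  "dehomogenize X = map (\<lambda>A. adj_mat (last X) * A) (butlast X)"

lemma poly_funs_dehomogenize:
  assumes "f \<in> poly_funs n m"
  obtains g where "g \<in> poly_funs n (Suc m)"
    "\<And>X. X \<in> mat_tuples n (Suc m) \<Longrightarrow> g X = f (dehomogenize X)"
proof
  \<comment> \<open>the cofactor of the last matrix, spelled out as a polynomial in the entries\<close>
  let ?c = "\<lambda>i j X. (-1) ^ (i + j) * det (mat (n - 1) (n - 1)
    (\<lambda>(a, b). (X ! m) $$ (if a < i then a else Suc a, if b < j then b else Suc b)))"
  let ?e = "\<lambda>k i j X. \<Sum>a<n. ?c a i X * (X ! k) $$ (a, j)"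
  let ?g = "\<lambda>X. f (map (\<lambda>k. mat n n (\<lambda>(i, j). ?e k i j X)) [0..<m])"
  have "?c i j \<in> poly_funs n (Suc m)" if "i < n" "j < n" for i j
    using that by (intro poly_funs.mult poly_funs.const poly_funs_det poly_funs.coord) auto
  then have "?e k i j \<in> poly_funs n (Suc m)" if "k < m" "i < n" "j < n" for k i j
    using that by (intro poly_funs_sum poly_funs.mult[of "?c _ _"] poly_funs.coord) auto
  then show "?g \<in> poly_funs n (Suc m)"
    by (intro poly_funs_subst[OF assms])
  fix X :: "'a mat list" assume X: "X \<in> mat_tuples n (Suc m)"
  then have "X \<noteq> []" by (auto simp: mat_tuples_def)
  then have last: "last X = X ! m" using mat_tuplesD[OF X] by (simp add: last_conv_nth)
  have "map (\<lambda>k. mat n n (\<lambda>(i, j). ?e k i j X)) [0..<m] = dehomogenize X"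
    unfolding dehomogenize_def last
  proof (rule nth_equalityI)
    fix k assume "k < length (map (\<lambda>k. mat n n (\<lambda>(i, j). ?e k i j X)) [0..<m])"
    then have k: "k < m" "k < Suc m" by simp_all
    show "map (\<lambda>k. mat n n (\<lambda>(i, j). ?e k i j X)) [0..<m] ! k
        = map (\<lambda>A. adj_mat (X ! m) * A) (butlast X) ! k"
      using mat_tuplesD(1)[OF X] mat_tuplesD(2)[OF X, of m] mat_tuplesD(2)[OF X k(2)] k(1)
      by (intro eq_matI)
        (auto simp: nth_butlast adj_mat_def scalar_prod_def cofactor_def mat_delete_def
          lessThan_atLeast0)
  qed (simp add: mat_tuplesD[OF X])
  then show "?g X = f (dehomogenize X)" by simp
qed

section \<open>The two group actions\<close>

lemma GL_group: "group (GL n)"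
  unfolding GL_def by (rule monoid.units_group[OF semiring.axioms(2)[OF semiring_mat]])

lemma GL_simps: "monoid.mult (GL n) = (*)" "monoid.one (GL n) = 1\<^sub>m n"
  by (simp_all add: GL_def units_of_def ring_mat_simps)

lemma GL_carrierD: "g \<in> carrier (GL n) \<Longrightarrow> g \<in> carrier_mat n n"
  by (simp add: GL_def units_of_def Units_def ring_mat_simps)

lemma GL_I:
  assumes "g \<in> carrier_mat n n" "h \<in> carrier_mat n n" "g * h = 1\<^sub>m n" "h * g = 1\<^sub>m n"
  shows "g \<in> carrier (GL n)" "inv\<^bsub>GL n\<^esub> g = h"
proof -
  have *: "x \<in> carrier (GL n)"
    if "x \<in> carrier_mat n n" "y \<in> carrier_mat n n" "x * y = 1\<^sub>m n" "y * x = 1\<^sub>m n" for x y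
    using that by (auto simp: GL_def units_of_def Units_def ring_mat_simps)
  show "g \<in> carrier (GL n)" using *[OF assms] .
  then show "inv\<^bsub>GL n\<^esub> g = h"
    using *[OF assms(2,1,4,3)] assms(4) by (intro group.inv_equality[OF GL_group]) (auto simp: GL_simps)
qed

lemma GL_inv:
  assumes "g \<in> carrier (GL n)"
  shows "inv\<^bsub>GL n\<^esub> g \<in> carrier_mat n n" "g * inv\<^bsub>GL n\<^esub> g = 1\<^sub>m n" "inv\<^bsub>GL n\<^esub> g * g = 1\<^sub>m n"
  using group.inv_closed[OF GL_group assms] group.r_inv[OF GL_group assms]
    group.l_inv[OF GL_group assms] by (auto simp: GL_simps dest: GL_carrierD)

lemma det_GL_inv:
  assumes "g \<in> carrier (GL n)"
  shows "det g * det (inv\<^bsub>GL n\<^esub> g) = 1"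
  using det_mult[OF GL_carrierD[OF assms] GL_inv(1)[OF assms]] GL_inv(2)[OF assms] by simp

lemma SL_subgroup: "subgroup {g \<in> carrier (GL n). det g = 1} (GL n)"
proof (rule group.subgroupI[OF GL_group])
  show "{g \<in> carrier (GL n). det g = 1} \<noteq> {}"
    using group.is_monoid[OF GL_group, THEN monoid.one_closed, of n] by (auto simp: GL_simps)
next
  fix a :: "'a mat" assume "a \<in> {g \<in> carrier (GL n). det g = 1}"
  then show "inv\<^bsub>GL n\<^esub> a \<in> {g \<in> carrier (GL n). det g = 1}"
    using det_GL_inv[of a n] by (simp add: group.inv_closed[OF GL_group])
next
  fix a b :: "'a mat" assume "a \<in> {g \<in> carrier (GL n). det g = 1}" "b \<in> {g \<in> carrier (GL n). det g = 1}"
  then show "a \<otimes>\<^bsub>GL n\<^esub> b \<in> {g \<in> carrier (GL n). det g = 1}"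
    using monoid.m_closed[OF group.is_monoid[OF GL_group], of a n b]
    by (auto simp: GL_simps det_mult[OF GL_carrierD GL_carrierD])
qed auto

lemma SL_inv:
  assumes "g \<in> carrier (SL n)"
  shows "g \<in> carrier (GL n)" "det g = 1" "inv\<^bsub>SL n\<^esub> g = inv\<^bsub>GL n\<^esub> g"
  using assms group.m_inv_consistent[OF GL_group SL_subgroup, of g n] by (auto simp: SL_def)

lemma conj_action_mat_tuples:
  assumes "g \<in> carrier (GL n)" "X \<in> mat_tuples n m"
  shows "conj_action n g X \<in> mat_tuples n m"
  using assms GL_carrierD[OF assms(1)] GL_inv(1)[OF assms(1)]
  by (auto simp: conj_action_def mat_tuples_def)

lemma left_right_action_mat_tuples:
  assumes "P \<in> carrier (SL n)" "Q \<in> carrier (SL n)" "X \<in> mat_tuples n m"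
  shows "left_right_action n (P, Q) X \<in> mat_tuples n m"
  using assms(3) GL_carrierD[OF SL_inv(1)[OF assms(1)]] GL_inv(1)[OF SL_inv(1)[OF assms(2)]]
  by (auto simp: left_right_action_def mat_tuples_def SL_inv[OF assms(2)])

text \<open>
  Scalars cancel in a conjugation, so $g$ may be divided by an $n$-th root of its determinant.
\<close>

lemma conj_action_SL:
  fixes g :: "'a::alg_closed_field mat"
  assumes "n > 0" "g \<in> carrier (GL n)"
  obtains h where "h \<in> carrier (SL n)"
    "\<And>X m. X \<in> mat_tuples n m \<Longrightarrow> conj_action n g X = conj_action n h X"
proof -
  obtain c where c: "c ^ n = det g"
    using nth_root_exists[OF assms(1)] by blast
  have "det g \<noteq> 0" using det_GL_inv[OF assms(2)] by auto
  then have [simp]: "c \<noteq> 0" using c assms(1) by (auto simp: zero_power)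
  note g = GL_carrierD[OF assms(2)] GL_inv[OF assms(2)]
  let ?h = "inverse c \<cdot>\<^sub>m g" and ?h' = "c \<cdot>\<^sub>m inv\<^bsub>GL n\<^esub> g"
  have carr: "?h \<in> carrier_mat n n" "?h' \<in> carrier_mat n n" using g by auto
  have "?h * ?h' = 1\<^sub>m n" "?h' * ?h = 1\<^sub>m n"
    using g by (auto simp: mult_smult_distrib[of _ n n _ n] mult_smult_assoc_mat[of _ n n _ n])
  note h = GL_I[OF carr this]
  have "det ?h = 1"
    using g(1) c \<open>det g \<noteq> 0\<close> by (simp add: power_inverse)
  with h have "?h \<in> carrier (SL n)" by (simp add: SL_def)
  moreover have "conj_action n g X = conj_action n ?h X" if "X \<in> mat_tuples n m" for X m
  proof -
    have "?h * A * ?h' = g * A * inv\<^bsub>GL n\<^esub> g" if A: "A \<in> carrier_mat n n" for A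
    proof -
      have "?h * A * ?h' = c \<cdot>\<^sub>m (inverse c \<cdot>\<^sub>m (g * A) * inv\<^bsub>GL n\<^esub> g)"
        using g A by (simp add: mult_smult_assoc_mat[of _ n n _ n] mult_smult_distrib[of _ n n _ n])
      also have "\<dots> = c \<cdot>\<^sub>m (inverse c \<cdot>\<^sub>m (g * A * inv\<^bsub>GL n\<^esub> g))"
        using g A by (simp add: mult_smult_assoc_mat[of "g * A" n n _ n])
      finally show ?thesis by (auto intro!: eq_matI)
    qed
    then show ?thesis
      using that unfolding conj_action_def h(2) by (auto simp: mat_tuples_def)
  qed
  ultimately show thesis by (rule that)
qed

lemma left_right_action_append_one:
  assumes "h \<in> carrier (SL n)"
  shows "left_right_action n (h, h) (X @ [1\<^sub>m n]) = conj_action n h X @ [1\<^sub>m n]"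
  using SL_inv[OF assms] GL_carrierD[of h n] GL_inv[of h n]
  by (simp add: left_right_action_def conj_action_def)

text \<open>
  The last entry of the transformed tuple is $P Q^{-1}$.  It has determinant one, hence its
  adjugate is $Q P^{-1}$, and multiplying $P A Q^{-1}$ by it replaces $P$ by $Q$.
\<close>

lemma dehomogenize_left_right_action:
  assumes P: "P \<in> carrier (SL n)" and Q: "Q \<in> carrier (SL n)" and X: "X \<in> mat_tuples n m"
  shows "dehomogenize (left_right_action n (P, Q) (X @ [1\<^sub>m n])) = conj_action n Q X"
proof -
  note p = GL_carrierD[OF SL_inv(1)[OF P]] GL_inv[OF SL_inv(1)[OF P]]
  note q = GL_carrierD[OF SL_inv(1)[OF Q]] GL_inv[OF SL_inv(1)[OF Q]]
  let ?P' = "inv\<^bsub>GL n\<^esub> P" and ?Q' = "inv\<^bsub>GL n\<^esub> Q"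
  let ?B = "P * ?Q'" and ?C = "Q * ?P'"
  have B: "?B \<in> carrier_mat n n" and C: "?C \<in> carrier_mat n n" using p q by auto
  have "det ?B = 1"
    using det_mult[OF p(1) q(2)] det_GL_inv[OF SL_inv(1)[OF Q]] SL_inv[OF P] SL_inv[OF Q] by simp
  then have adj: "adj_mat ?B * ?B = 1\<^sub>m n" "adj_mat ?B \<in> carrier_mat n n"
    using adj_mat[OF B] by auto
  have "?B * ?C = ?B * Q * ?P'"
    using p q by (intro assoc_mult_mat[symmetric]) auto
  also have "?B * Q = P * (?Q' * Q)"
    using p q by (intro assoc_mult_mat) auto
  finally have "?B * ?C = P * (?Q' * Q) * ?P'" .
  then have BC: "?B * ?C = 1\<^sub>m n" using p q by simp
  have "adj_mat ?B = adj_mat ?B * (?B * ?C)" using BC adj(2) by simp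
  also have "\<dots> = (adj_mat ?B * ?B) * ?C"
    using adj(2) B C by (simp add: assoc_mult_mat[of _ n n _ n _ n])
  finally have adj_eq: "adj_mat ?B = ?C" unfolding adj(1) left_mult_one_mat[OF C] .
  have "?C * (P * A * ?Q') = Q * A * ?Q'" if "A \<in> carrier_mat n n" for A
  proof -
    have "?C * (P * A * ?Q') = Q * (?P' * (P * (A * ?Q')))"
      using p q that by (simp add: assoc_mult_mat[of _ n n _ n _ n])
    also have "?P' * (P * (A * ?Q')) = (?P' * P) * (A * ?Q')"
      using p q that by (intro assoc_mult_mat[symmetric]) auto
    finally show ?thesis
      using p q that by (simp add: assoc_mult_mat[of _ n n _ n _ n])
  qed
  then show ?thesis
    using X p q
    by (auto simp: dehomogenize_def left_right_action_def conj_action_def mat_tuples_def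
        SL_inv[OF Q] adj_eq)
qed

section \<open>Orbit closures and invariants\<close>

text \<open>
  A polynomial $f$ that vanishes on the left-right orbit of $(v, 1)$ gives the polynomial
  $X \mapsto f(X, 1)$ that vanishes on the conjugation orbit of $v$, and hence at $z$.
\<close>

lemma closure_append_one:
  fixes v :: "'a::alg_closed_field mat list"
  assumes "n > 0" "v \<in> mat_tuples n m" "z \<in> zariski_closure n m (orbit (GL n) (conj_action n) v)"
  shows "z @ [1\<^sub>m n] \<in>
    zariski_closure n (Suc m) (orbit (SL n \<times>\<times> SL n) (left_right_action n) (v @ [1\<^sub>m n]))"
  unfolding zariski_closure_def
proof (intro CollectI conjI ballI impI)
  have z: "z \<in> mat_tuples n m" using assms(3) by (simp add: zariski_closure_def)
  then show "z @ [1\<^sub>m n] \<in> mat_tuples n (Suc m)" by (simp add: append_mat_tuples)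
  fix f :: "'a mat list \<Rightarrow> 'a" assume f: "f \<in> poly_funs n (Suc m)"
    and vanish: "\<forall>y\<in>orbit (SL n \<times>\<times> SL n) (left_right_action n) (v @ [1\<^sub>m n]). f y = 0"
  obtain g where g: "g \<in> poly_funs n m" "\<And>X. X \<in> mat_tuples n m \<Longrightarrow> g X = f (X @ [1\<^sub>m n])"
    using poly_funs_append_one[OF f] by metis
  have "g y = 0" if y: "y \<in> orbit (GL n) (conj_action n) v" for y
  proof -
    obtain a where a: "a \<in> carrier (GL n)" "y = conj_action n a v"
      using y by (auto simp: orbit_def DirProd_def)
    obtain h where h: "h \<in> carrier (SL n)" "y = conj_action n h v"
      using conj_action_SL[OF assms(1) a(1)] assms(2) a(2) by metis
    have "y @ [1\<^sub>m n] = left_right_action n (h, h) (v @ [1\<^sub>m n])"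
      using h by (simp add: left_right_action_append_one)
    then have "f (y @ [1\<^sub>m n]) = 0"
      using vanish h(1) by (auto simp: orbit_def DirProd_def)
    then show ?thesis
      using g(2) conj_action_mat_tuples[OF a(1) assms(2)] a(2) by simp
  qed
  then have "g z = 0" using assms(3) g(1) by (auto simp: zariski_closure_def)
  then show "f (z @ [1\<^sub>m n]) = 0" using g(2) z by simp
qed

lemma dehomogenize_mat_tuples:
  assumes "z \<in> mat_tuples n (Suc m)"
  shows "dehomogenize z \<in> mat_tuples n m"
proof -
  have "z \<noteq> []" using assms by (auto simp: mat_tuples_def)
  then have "last z \<in> carrier_mat n n" "set (butlast z) \<subseteq> carrier_mat n n"
    using assms by (auto simp: mat_tuples_def dest: in_set_butlastD)
  then show ?thesis
    using assms adj_mat(1)[of "last z" n] by (auto simp: dehomogenize_def mat_tuples_def)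
qed

text \<open>
  A polynomial that vanishes on the conjugation orbit of $v$, composed with
  \<^const>\<open>dehomogenize\<close>, vanishes on the left-right orbit of $(v, 1)$, and hence at $z$.
\<close>

lemma closure_dehomogenize:
  assumes v: "v \<in> mat_tuples n m"
    and z: "z \<in> zariski_closure n (Suc m)
      (orbit (SL n \<times>\<times> SL n) (left_right_action n) (v @ [1\<^sub>m n]))"
  shows "dehomogenize z \<in> zariski_closure n m (orbit (GL n) (conj_action n) v)"
  unfolding zariski_closure_def
proof (intro CollectI conjI ballI impI)
  have z': "z \<in> mat_tuples n (Suc m)" using z by (simp add: zariski_closure_def)
  then show "dehomogenize z \<in> mat_tuples n m" by (rule dehomogenize_mat_tuples)
  fix f :: "'a mat list \<Rightarrow> 'a" assume f: "f \<in> poly_funs n m"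
    and vanish: "\<forall>y\<in>orbit (GL n) (conj_action n) v. f y = 0"
  obtain g where g: "g \<in> poly_funs n (Suc m)"
      "\<And>X. X \<in> mat_tuples n (Suc m) \<Longrightarrow> g X = f (dehomogenize X)"
    using poly_funs_dehomogenize[OF f] by metis
  have "g y = 0"
    if y: "y \<in> orbit (SL n \<times>\<times> SL n) (left_right_action n) (v @ [1\<^sub>m n])" for y
  proof -
    obtain P Q where PQ: "P \<in> carrier (SL n)" "Q \<in> carrier (SL n)"
        "y = left_right_action n (P, Q) (v @ [1\<^sub>m n])"
      using y by (auto simp: orbit_def DirProd_def)
    have "y \<in> mat_tuples n (Suc m)"
      unfolding PQ(3) using PQ(1,2) append_mat_tuples[OF v] by (simp add: left_right_action_mat_tuples)
    moreover have "dehomogenize y \<in> orbit (GL n) (conj_action n) v"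
      unfolding PQ(3) dehomogenize_left_right_action[OF PQ(1,2) v]
      using SL_inv(1)[OF PQ(2)] by (auto simp: orbit_def DirProd_def)
    ultimately show ?thesis using g(2) vanish by simp
  qed
  then have "g z = 0" using z g(1) by (auto simp: zariski_closure_def)
  then show "f (dehomogenize z) = 0" using g(2) z' by simp
qed

lemma orbit_closure_equiv_append_one:
  fixes v w :: "'a::alg_closed_field mat list"
  assumes "n > 0" "v \<in> mat_tuples n m" "w \<in> mat_tuples n m"
  shows "orbit_closure_equiv n (Suc m) (SL n \<times>\<times> SL n) (left_right_action n) (v @ [1\<^sub>m n]) (w @ [1\<^sub>m n])
    \<longleftrightarrow> orbit_closure_equiv n m (GL n) (conj_action n) v w"
  unfolding orbit_closure_equiv_def
  using closure_append_one[OF assms(1)] closure_dehomogenize assms(2,3) by blast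

lemma invariants_append_one:
  fixes f :: "'a::alg_closed_field mat list \<Rightarrow> 'a"
  assumes "n > 0" "f \<in> invariants n (Suc m) (SL n \<times>\<times> SL n) (left_right_action n)"
  obtains g where "g \<in> invariants n m (GL n) (conj_action n)"
    "\<And>X. X \<in> mat_tuples n m \<Longrightarrow> g X = f (X @ [1\<^sub>m n])"
proof -
  have f: "f \<in> poly_funs n (Suc m)" and inv: "\<And>P Q X. P \<in> carrier (SL n) \<Longrightarrow> Q \<in> carrier (SL n)
      \<Longrightarrow> X \<in> mat_tuples n (Suc m) \<Longrightarrow> f (left_right_action n (P, Q) X) = f X"
    using assms(2) by (auto simp: invariants_def)
  obtain g where g: "g \<in> poly_funs n m" "\<And>X. X \<in> mat_tuples n m \<Longrightarrow> g X = f (X @ [1\<^sub>m n])"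
    using poly_funs_append_one[OF f] by metis
  have "g (conj_action n a X) = g X" if a: "a \<in> carrier (GL n)" and X: "X \<in> mat_tuples n m" for a X
  proof -
    obtain h where h: "h \<in> carrier (SL n)" "conj_action n a X = conj_action n h X"
      using conj_action_SL[OF assms(1) a] X by metis
    have "f (conj_action n h X @ [1\<^sub>m n]) = f (X @ [1\<^sub>m n])"
      using inv[OF h(1) h(1) append_mat_tuples[OF X one_carrier_mat]] h(1)
      by (simp add: left_right_action_append_one)
    then show ?thesis
      using g(2) X conj_action_mat_tuples[OF a X] h(2) by simp
  qed
  then have "g \<in> invariants n m (GL n) (conj_action n)"
    unfolding invariants_def using g(1) by blast
  then show thesis using that g(2) by blast
qed

section \<open>Circuits\<close>

lemma foldl_const_gates:
  "foldl (\<lambda>vs g. vs @ [gate_value vs g]) xs (map Const cs) = xs @ cs"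
  by (induction cs arbitrary: xs) auto

text \<open>
  Constant gates at the beginning of a circuit act as additional inputs, placed after the
  proper ones; the operand indices of the remaining gates do not change.
\<close>

lemma circuit_value_const_gates:
  "circuit_value (map Const cs @ c) xs = circuit_value c (xs @ cs)"
  by (simp add: circuit_value_def foldl_const_gates)

lemma circuit_ok_const_gates:
  assumes "circuit_ok (N + length cs) c"
  shows "circuit_ok N (map Const cs @ c)"
  unfolding circuit_ok_def
proof (intro allI impI)
  fix k assume k: "k < length (map Const cs @ c)"
  show "gate_ok (N + k) ((map Const cs @ c) ! k)"
  proof (cases "k < length cs")
    case False
    then have "k - length cs < length c" using k by simp
    then have "gate_ok (N + length cs + (k - length cs)) (c ! (k - length cs))"
      using assms by (simp only: circuit_ok_def)
    moreover have "N + length cs + (k - length cs) = N + k" using False by simp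
    ultimately show ?thesis using False by (simp add: nth_append)
  qed (simp add: nth_append)
qed

lemma entries_append: "entries (X @ Y) = entries X @ entries Y"
  by (simp add: entries_def)

lemma length_entries:
  assumes "X \<in> mat_tuples n m"
  shows "length (entries X) = m * n * n"
proof -
  have len: "length (concat (mat_to_list A)) = n * n" if "A \<in> carrier_mat n n" for A :: "'a mat"
    using that by (simp add: mat_to_list_def length_concat comp_def sum_list_triv)
  have "length X = m" "set X \<subseteq> carrier_mat n n" using assms by (auto simp: mat_tuples_def)
  then show ?thesis
    by (induction X arbitrary: m) (auto simp: entries_def len algebra_simps)
qed

definition id_entries :: "nat \<Rightarrow> 'a::field list" where
  "id_entries n = entries [1\<^sub>m n]"

lemma length_id_entries: "length (id_entries n) = n * n"
  using length_entries[of "[1\<^sub>m n]" n 1] by (simp add: id_entries_def mat_tuples_def)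

lemma concat_nth_uniform:
  assumes "\<And>ys. ys \<in> set xss \<Longrightarrow> length ys = n" "k < length xss * n"
  shows "concat xss ! k = xss ! (k div n) ! (k mod n)"
  using assms
proof (induction xss arbitrary: k)
  case (Cons ys xss)
  then have n: "n > 0" by (cases n) auto
  show ?case
  proof (cases "k < n")
    case False
    then have "k div n = Suc ((k - n) div n)" "k mod n = (k - n) mod n"
      using n by (simp_all add: le_div_geq le_mod_geq)
    then show ?thesis using False Cons by (simp add: nth_append)
  qed (use Cons in \<open>simp add: nth_append\<close>)
qed simp

text \<open>
  In row order, the diagonal entries of an $n \times n$ matrix are the multiples of $n + 1$; this is
  how the program finds them.
\<close>

lemma id_entries_nth:
  assumes "k < n * n"
  shows "id_entries n ! k = (if \<exists>j<n. k = j * Suc n then 1 else 0)"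
proof -
  have n: "n > 0" using assms by (cases n) auto
  have "k div n < n" "k mod n < n" using assms n by (simp_all add: less_mult_imp_div_less)
  have "length ys = n" if "ys \<in> set (mat_to_list (1\<^sub>m n :: 'a mat))" for ys
    using that by (auto simp: mat_to_list_def)
  moreover have "k < length (mat_to_list (1\<^sub>m n :: 'a mat)) * n"
    using assms by (simp add: mat_to_list_def)
  ultimately have "concat (mat_to_list (1\<^sub>m n :: 'a mat)) ! k = mat_to_list (1\<^sub>m n) ! (k div n) ! (k mod n)"
    by (rule concat_nth_uniform)
  then have "id_entries n ! k = (if k div n = k mod n then 1 else 0 :: 'a)"
    using \<open>k div n < n\<close> \<open>k mod n < n\<close> by (simp add: id_entries_def entries_def mat_to_list_def)
  moreover have "k div n = k mod n \<longleftrightarrow> (\<exists>j<n. k = j * Suc n)"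
  proof
    assume "k div n = k mod n"
    then have "k = (k mod n) * Suc n" using div_mult_mod_eq[of k n] by simp
    then show "\<exists>j<n. k = j * Suc n" using \<open>k mod n < n\<close> by blast
  next
    assume "\<exists>j<n. k = j * Suc n"
    then obtain j where "j < n" "k = j + j * n" by auto
    then show "k div n = k mod n" by simp
  qed
  ultimately show ?thesis by simp
qed

fun extend_answer :: "nat \<Rightarrow> 'a::field circuit option \<Rightarrow> 'a circuit option" where
  "extend_answer n None = None"
| "extend_answer n (Some c) = Some (map Const (id_entries n) @ c)"

lemma extend_answer_correct:
  fixes v w :: "'a::alg_closed_field mat list"
  assumes n: "n > 0" and v: "v \<in> mat_tuples n m" and w: "w \<in> mat_tuples n m"
    and ans: "matrix_semi_invariants_problem n (Suc m) (v @ [1\<^sub>m n]) (w @ [1\<^sub>m n]) ans"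
  shows "matrix_invariants_problem n m v w (extend_answer n ans)"
proof (cases ans)
  case None
  then show ?thesis
    using ans orbit_closure_equiv_append_one[OF n v w]
    by (simp add: matrix_semi_invariants_problem_def matrix_invariants_problem_def
        orbit_closure_problem_def)
next
  case (Some c)
  then have neq: "\<not> orbit_closure_equiv n m (GL n) (conj_action n) v w"
    using ans orbit_closure_equiv_append_one[OF n v w]
    by (simp add: matrix_semi_invariants_problem_def orbit_closure_problem_def)
  obtain f where f: "f \<in> invariants n (Suc m) (SL n \<times>\<times> SL n) (left_right_action n)"
      "computes n (Suc m) c f" "f (v @ [1\<^sub>m n]) \<noteq> f (w @ [1\<^sub>m n])"
    using ans Some by (auto simp: matrix_semi_invariants_problem_def orbit_closure_problem_def)
  obtain g where g: "g \<in> invariants n m (GL n) (conj_action n)"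
      "\<And>X. X \<in> mat_tuples n m \<Longrightarrow> g X = f (X @ [1\<^sub>m n])"
    using invariants_append_one[OF n f(1)] by metis
  have "computes n m (map Const (id_entries n) @ c) g"
    unfolding computes_def
  proof (intro conjI ballI)
    show "circuit_ok (m * n * n) (map Const (id_entries n) @ c)"
      using f(2) by (intro circuit_ok_const_gates)
        (simp add: length_id_entries computes_def algebra_simps)
    fix X :: "'a mat list" assume X: "X \<in> mat_tuples n m"
    have "circuit_value c (entries (X @ [1\<^sub>m n])) = f (X @ [1\<^sub>m n])"
      using f(2) append_mat_tuples[OF X one_carrier_mat] unfolding computes_def by blast
    then show "circuit_value (map Const (id_entries n) @ c) (entries X) = g X"
      using g(2)[OF X] by (simp add: circuit_value_const_gates entries_append id_entries_def)
  qed
  moreover have "g v \<noteq> g w" using g(2) v w f(3) by simp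
  ultimately show ?thesis
    using Some neq g(1) by (auto simp: matrix_invariants_problem_def orbit_closure_problem_def)
qed

section \<open>Running programs\<close>

text \<open>
  Total correctness with a time bound.  The bound is a fixed number, not a function of the state,
  so that bounds are added by sequences and multiplied by loops.
\<close>

definition runs_within ::
  "'a::field solver \<Rightarrow> ('a state \<Rightarrow> bool) \<Rightarrow> 'a prog \<Rightarrow> nat \<Rightarrow> ('a state \<Rightarrow> bool) \<Rightarrow> bool" where
  "runs_within alg P p T Q \<longleftrightarrow> (\<forall>s. P s \<longrightarrow> (\<exists>t s'. exec alg p s t s' \<and> t \<le> T \<and> Q s'))"

lemma runs_within_Seq:
  assumes "runs_within alg P p T Q" "runs_within alg Q q U R"
  shows "runs_within alg P (Seq p q) (T + U) R"
  using assms unfolding runs_within_def by (meson exec.Seq add_mono)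

fun block :: "'a instr list \<Rightarrow> 'a prog" where
  "block [] = Skip"
| "block (i # is) = Seq (Instr i) (block is)"

lemma runs_within_block:
  assumes "\<And>s. P s \<Longrightarrow> Q (fold exec_instr is s)" "length is = T"
  shows "runs_within alg P (block is) T Q"
proof -
  have "exec alg (block is) s (length is) (fold exec_instr is s)" for s
  proof (induction "is" arbitrary: s)
    case (Cons i "is")
    then show ?case using exec.Seq[OF exec.Instr Cons.IH] by simp
  qed (simp add: exec.Skip)
  then show ?thesis using assms unfolding runs_within_def by blast
qed

text \<open>
  The body must neither change the counter $r$ nor the register $b$ that holds the number of rounds.
\<close>

definition for_loop :: "nat \<Rightarrow> nat \<Rightarrow> 'a prog \<Rightarrow> 'a prog" where
  "for_loop r b p = Seq (Instr (SetI r 0)) (While (LessI r b) (Seq p (Instr (IncI r))))"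

text \<open>
  The invariant is indexed by the number of completed rounds.  It must not mention the counter
  register, which the loop itself resets and increments.  The time estimate uses a bound $B$ on
  the number of rounds so that nested loops get bounds in one variable.
\<close>

lemma runs_within_for_loop:
  assumes body: "\<And>i. i < k \<Longrightarrow> runs_within alg (\<lambda>s. I i s \<and> reg s r = i) p T
      (\<lambda>s. I (Suc i) s \<and> reg s r = i)"
    and bound: "\<And>i s. I i s \<Longrightarrow> reg s b = k"
    and counter: "\<And>i x s. I i s \<Longrightarrow> I i (set_reg r x s)"
    and init: "\<And>s. P s \<Longrightarrow> I 0 s"
    and result: "\<And>s. I k s \<Longrightarrow> Q s"
    and "k \<le> B"
  shows "runs_within alg P (for_loop r b p) (2 + B * (T + 2)) Q"
  unfolding runs_within_def
proof (intro allI impI)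
  let ?W = "While (LessI r b) (Seq p (Instr (IncI r)))"
  have loop: "\<exists>t s'. exec alg ?W s t s' \<and> t \<le> 1 + j * (T + 2) \<and> I k s'"
    if "I i s" "reg s r = i" "i + j = k" for i j s
    using that
  proof (induction j arbitrary: i s)
    case 0
    then have "exec alg ?W s 1 s" using bound by (intro exec.WhileF) simp
    then show ?case using 0 by auto
  next
    case (Suc j)
    then have "i < k" by simp
    from body[OF this] Suc.prems obtain t s1 where s1: "exec alg p s t s1" "t \<le> T"
        "I (Suc i) s1" "reg s1 r = i"
      unfolding runs_within_def by blast
    let ?s2 = "set_reg r (Suc i) s1"
    have step: "exec alg (Seq p (Instr (IncI r))) s (t + 1) ?s2"
      using exec.Seq[OF s1(1) exec.Instr[of alg "IncI r"]] s1(4) by simp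
    have "I (Suc i) ?s2" using counter s1(3) .
    moreover have "reg ?s2 r = Suc i" "Suc i + j = k"
      using Suc.prems(3) by (simp_all add: set_reg_def)
    ultimately obtain u s' where s': "exec alg ?W ?s2 u s'" "u \<le> 1 + j * (T + 2)"
        "I k s'"
      using Suc.IH by blast
    have "exec alg ?W s (1 + (t + 1) + u) s'"
      using \<open>i < k\<close> Suc.prems(2) bound[OF Suc.prems(1)] by (intro exec.WhileT[OF _ step s'(1)]) simp
    moreover have "1 + (t + 1) + u \<le> 1 + Suc j * (T + 2)" using s1(2) s'(2) by simp
    ultimately show ?case using s'(3) by blast
  qed
  fix s assume "P s"
  then have "I 0 (set_reg r 0 s)" "reg (set_reg r 0 s) r = 0" "0 + k = k"
    using init[of s] counter by (auto simp: set_reg_def)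
  from loop[OF this] obtain t s' where s': "exec alg ?W (set_reg r 0 s) t s'"
      "t \<le> 1 + k * (T + 2)" "I k s'"
    by blast
  have "exec alg (for_loop r b p) s (1 + t) s'"
    unfolding for_loop_def using exec.Seq[OF exec.Instr[of alg "SetI r 0"]] s'(1) by simp
  moreover have "k * (T + 2) \<le> B * (T + 2)" using \<open>k \<le> B\<close> by (rule mult_le_mono1)
  then have "1 + t \<le> 2 + B * (T + 2)" using s'(2) by linarith
  ultimately show "\<exists>t s'. exec alg (for_loop r b p) s t s' \<and> t \<le> 2 + B * (T + 2) \<and> Q s'"
    using result s'(3) by blast
qed

section \<open>The reduction\<close>

text \<open>
  There is no multiplication of indices, so the address $m n^2$ of the appended matrix is
  reached by counting in register 6.
\<close>

definition locate_end :: "'a::field prog" where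
  "locate_end = for_loop 3 1 (for_loop 4 0 (for_loop 5 0 (block [IncI 6])))"

text \<open>
  Registers 6 and 7 run through the diagonal of the appended matrix in the two points and in the
  constants of the new gates.  They advance by $n + 1$ per row, whereas register 2 advances by $n$
  only, so that it ends with $n^2$, the address that is passed to the solver.
\<close>

definition write_identity :: "'a::field prog" where
  "write_identity = for_loop 3 0 (Seq (block [SetF (0, 6) 1, SetF (1, 6) 1, SetF (2, 7) 1])
     (Seq (for_loop 4 0 (block [IncI 6, IncI 7, IncI 2])) (block [IncI 6, IncI 7])))"

text \<open>
  The final loop adds $n^2$ to the number of gates.  It can do without a case distinction on the
  answer: if the orbit closures intersect, only register 0 is read, and the loop leaves it alone.
\<close>

definition reduction :: "'a::field prog" where
  "reduction = Seq locate_end (Seq write_identity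
     (Seq (block [IncI 1]) (Seq Call (for_loop 3 2 (block [IncI 1])))))"

text \<open>
  An array in which the first $i$ diagonal positions of an $n \times n$ matrix stored at address $d$
  are set to one.
\<close>

definition ones :: "nat \<Rightarrow> nat \<Rightarrow> nat \<Rightarrow> (nat \<Rightarrow> 'a::field) \<Rightarrow> nat \<Rightarrow> 'a" where
  "ones d n i h x = (if \<exists>j<i. x = d + j * Suc n then 1 else h x)"

lemma ones_0: "ones d n 0 h = h"
  by (auto simp: ones_def)

lemma ones_Suc: "(ones d n i h)(d + i * Suc n := 1) = ones d n (Suc i) h"
  by (rule ext) (auto simp: ones_def less_Suc_eq simp del: mult_Suc_right)

text \<open>
  The state before the call, after $i$ diagonal entries have been written: $a$ is the future
  address of the witness, $p$ and $q$ are the positions in the points and among the constants.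
\<close>

definition config ::
  "nat \<Rightarrow> nat \<Rightarrow> (nat \<Rightarrow> 'a::field) \<Rightarrow> (nat \<Rightarrow> 'a) \<Rightarrow> nat \<Rightarrow> nat \<Rightarrow> nat \<Rightarrow> nat \<Rightarrow> 'a state \<Rightarrow> bool" where
  "config n m h0 h1 i a p q s \<longleftrightarrow>
     reg s 0 = n \<and> reg s 1 = m \<and> reg s 2 = a \<and> reg s 6 = p \<and> reg s 7 = q \<and>
     iarr s 0 = (\<lambda>_. 0) \<and> farr s 0 = ones (m * n * n) n i h0 \<and>
     farr s 1 = ones (m * n * n) n i h1 \<and> farr s 2 = ones 0 n i (\<lambda>_. 0)"

lemma runs_locate_end:
  assumes "n \<le> N" "m \<le> N"
  shows "runs_within alg (config n m h0 h1 0 0 0 0) locate_end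
    (2 + N * (2 + N * (2 + N * (1 + 2) + 2) + 2)) (config n m h0 h1 0 0 (m * n * n) 0)"
proof -
  let ?c = "\<lambda>p. config n m h0 h1 0 0 p 0"
  have inner: "runs_within alg (\<lambda>s. (?c p s \<and> reg s 3 = i) \<and> reg s 4 = j)
      (for_loop 5 0 (block [IncI 6])) (2 + N * (1 + 2))
      (\<lambda>s. (?c (p + n) s \<and> reg s 3 = i) \<and> reg s 4 = j)" for p i j
  proof (rule runs_within_for_loop[where k = n and
        I = "\<lambda>k s. (?c (p + k) s \<and> reg s 3 = i) \<and> reg s 4 = j"])
    fix k show "runs_within alg (\<lambda>s. ((?c (p + k) s \<and> reg s 3 = i) \<and> reg s 4 = j) \<and> reg s 5 = k)
      (block [IncI 6]) 1 (\<lambda>s. ((?c (p + Suc k) s \<and> reg s 3 = i) \<and> reg s 4 = j) \<and> reg s 5 = k)"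
      by (rule runs_within_block) (auto simp: config_def set_reg_def)
  qed (use assms in \<open>auto simp: config_def set_reg_def\<close>)
  have middle: "runs_within alg (\<lambda>s. ?c p s \<and> reg s 3 = i)
      (for_loop 4 0 (for_loop 5 0 (block [IncI 6]))) (2 + N * (2 + N * (1 + 2) + 2))
      (\<lambda>s. ?c (p + n * n) s \<and> reg s 3 = i)" for p i
  proof (rule runs_within_for_loop[where k = n and I = "\<lambda>j s. ?c (p + j * n) s \<and> reg s 3 = i"])
    fix j show "runs_within alg (\<lambda>s. (?c (p + j * n) s \<and> reg s 3 = i) \<and> reg s 4 = j)
        (for_loop 5 0 (block [IncI 6])) (2 + N * (1 + 2))
        (\<lambda>s. (?c (p + Suc j * n) s \<and> reg s 3 = i) \<and> reg s 4 = j)"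
      using inner[of "p + j * n" i j] by (simp add: add_ac del: block.simps)
  qed (use assms in \<open>auto simp: config_def set_reg_def\<close>)
  show ?thesis
    unfolding locate_end_def
  proof (rule runs_within_for_loop[where k = m and I = "\<lambda>i. ?c (i * (n * n))"])
    fix i show "runs_within alg (\<lambda>s. ?c (i * (n * n)) s \<and> reg s 3 = i)
        (for_loop 4 0 (for_loop 5 0 (block [IncI 6]))) (2 + N * (2 + N * (1 + 2) + 2))
        (\<lambda>s. ?c (Suc i * (n * n)) s \<and> reg s 3 = i)"
      using middle[of "i * (n * n)" i] by (simp add: add_ac del: block.simps)
  qed (use assms in \<open>auto simp: config_def set_reg_def mult.assoc\<close>)
qed

lemma runs_write_identity:
  assumes "n \<le> N"
  shows "runs_within alg (config n m h0 h1 0 0 (m * n * n) 0) write_identity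
    (2 + N * (3 + ((2 + N * (3 + 2)) + 2) + 2))
    (\<lambda>s. \<exists>p q. config n m h0 h1 n (n * n) p q s)"
proof -
  let ?d = "m * n * n"
  let ?c = "config n m h0 h1"
  have ones: "runs_within alg
      (\<lambda>s. ?c i (i * n) (?d + i * Suc n) (i * Suc n) s \<and> reg s 3 = i)
      (block [SetF (0, 6) 1, SetF (1, 6) 1, SetF (2, 7) 1]) 3
      (\<lambda>s. ?c (Suc i) (i * n) (?d + i * Suc n) (i * Suc n) s \<and> reg s 3 = i)" for i
    using ones_Suc[of 0 n i "\<lambda>_. 0"]
    by (intro runs_within_block)
      (auto simp: config_def set_fcell_def ones_Suc simp del: mult_Suc_right)
  have row: "runs_within alg
      (\<lambda>s. ?c (Suc i) (i * n) (?d + i * Suc n) (i * Suc n) s \<and> reg s 3 = i)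
      (for_loop 4 0 (block [IncI 6, IncI 7, IncI 2])) (2 + N * (3 + 2))
      (\<lambda>s. ?c (Suc i) (i * n + n) (?d + i * Suc n + n) (i * Suc n + n) s \<and> reg s 3 = i)" for i
  proof (rule runs_within_for_loop[where k = n and
        I = "\<lambda>j s. ?c (Suc i) (i * n + j) (?d + i * Suc n + j) (i * Suc n + j) s \<and> reg s 3 = i"])
    fix j show "runs_within alg
        (\<lambda>s. (?c (Suc i) (i * n + j) (?d + i * Suc n + j) (i * Suc n + j) s \<and> reg s 3 = i) \<and> reg s 4 = j)
        (block [IncI 6, IncI 7, IncI 2]) 3
        (\<lambda>s. (?c (Suc i) (i * n + Suc j) (?d + i * Suc n + Suc j) (i * Suc n + Suc j) s \<and> reg s 3 = i)
          \<and> reg s 4 = j)"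
      by (rule runs_within_block) (auto simp: config_def set_reg_def)
  qed (use assms in \<open>auto simp: config_def set_reg_def\<close>)
  have skip: "runs_within alg
      (\<lambda>s. ?c (Suc i) (i * n + n) (?d + i * Suc n + n) (i * Suc n + n) s \<and> reg s 3 = i)
      (block [IncI 6, IncI 7]) 2
      (\<lambda>s. ?c (Suc i) (Suc i * n) (?d + Suc i * Suc n) (Suc i * Suc n) s \<and> reg s 3 = i)" for i
    by (rule runs_within_block) (auto simp: config_def set_reg_def)
  show ?thesis
    unfolding write_identity_def
  proof (rule runs_within_for_loop[where k = n and
        I = "\<lambda>i. ?c i (i * n) (?d + i * Suc n) (i * Suc n)"])
    fix i show "runs_within alg
        (\<lambda>s. ?c i (i * n) (?d + i * Suc n) (i * Suc n) s \<and> reg s 3 = i)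
        (Seq (block [SetF (0, 6) 1, SetF (1, 6) 1, SetF (2, 7) 1])
          (Seq (for_loop 4 0 (block [IncI 6, IncI 7, IncI 2])) (block [IncI 6, IncI 7])))
        (3 + ((2 + N * (3 + 2)) + 2))
        (\<lambda>s. ?c (Suc i) (Suc i * n) (?d + Suc i * Suc n) (Suc i * Suc n) s \<and> reg s 3 = i)"
      by (rule runs_within_Seq[OF ones runs_within_Seq[OF row skip]])
  qed (use assms in \<open>auto simp: config_def set_reg_def\<close>)
qed

lemma map_ones_entries:
  assumes "X \<in> mat_tuples n m"
  shows "map (ones (m * n * n) n n (overwrite 0 (entries X) (\<lambda>_. 0))) [0..<Suc m * n * n] =
    entries (X @ [1\<^sub>m n])"
proof (rule nth_equalityI)
  show "length (map (ones (m * n * n) n n (overwrite 0 (entries X) (\<lambda>_. 0))) [0..<Suc m * n * n]) =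
    length (entries (X @ [1\<^sub>m n]))"
    using length_entries[OF append_mat_tuples[OF assms one_carrier_mat]] by simp
next
  fix k assume "k < length (map (ones (m * n * n) n n (overwrite 0 (entries X) (\<lambda>_. 0))) [0..<Suc m * n * n])"
  then have k: "k < m * n * n + n * n" by (simp add: algebra_simps)
  have split: "entries (X @ [1\<^sub>m n]) = entries X @ id_entries n"
    by (simp add: entries_append id_entries_def)
  have "ones (m * n * n) n n (overwrite 0 (entries X) (\<lambda>_. 0)) k = entries (X @ [1\<^sub>m n]) ! k"
  proof (cases "k < m * n * n")
    case True
    then show ?thesis
      by (simp add: ones_def overwrite_def split nth_append length_entries[OF assms])
  next
    case False
    then obtain l where l: "k = m * n * n + l" by (metis le_iff_add not_less)
    then have "l < n * n" using k by simp
    then show ?thesis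
      unfolding l by (simp add: ones_def overwrite_def split nth_append length_entries[OF assms] id_entries_nth)
  qed
  then show "map (ones (m * n * n) n n (overwrite 0 (entries X) (\<lambda>_. 0))) [0..<Suc m * n * n] ! k =
      entries (X @ [1\<^sub>m n]) ! k"
    using k by (simp add: algebra_simps)
qed

text \<open>
  The state after the call, with $i$ added to the number of gates.  The state \<open>s0\<close> at the call is
  needed because the gates below address $n^2$ still come from it.
\<close>

definition shifted :: "nat \<Rightarrow> 'a::field circuit option \<Rightarrow> nat \<Rightarrow> 'a state \<Rightarrow> bool" where
  "shifted n ans i s \<longleftrightarrow> (\<exists>s0. reg s0 2 = n * n \<and> iarr s0 0 = (\<lambda>_. 0) \<and>
     farr s0 2 = ones 0 n n (\<lambda>_. 0) \<and> reg s 0 = reg (store_answer ans s0) 0 \<and>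
     reg s 1 = reg (store_answer ans s0) 1 + i \<and> reg s 2 = n * n \<and>
     iarr s = iarr (store_answer ans s0) \<and> farr s = farr (store_answer ans s0))"

lemma shifted_store_answer:
  assumes "reg s 2 = n * n" "iarr s 0 = (\<lambda>_. 0)" "farr s 2 = ones 0 n n (\<lambda>_. 0)"
  shows "shifted n ans 0 (store_answer ans s)"
proof -
  have "reg (store_answer ans s) 2 = n * n"
    using assms(1) by (simp add: store_answer_def split: option.split)
  then show ?thesis
    unfolding shifted_def using assms by (intro exI[of _ s]) simp
qed

lemma shifted_set_reg:
  "r \<notin> {0, 1, 2} \<Longrightarrow> shifted n ans i (set_reg r x s) = shifted n ans i s"
  by (simp add: shifted_def set_reg_def)

lemma shifted_Suc:
  "shifted n ans i s \<Longrightarrow> shifted n ans (Suc i) (set_reg 1 (Suc (reg s 1)) s)"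
  by (simp add: shifted_def set_reg_def)

lemma shifted_reg_2: "shifted n ans i s \<Longrightarrow> reg s 2 = n * n"
  by (auto simp: shifted_def)

text \<open>
  Below address $n^2$ the memory holds the constant gates written before the call: their kind is
  the initial value zero, their constants are the entries of the identity matrix.  From there
  on it holds the solver's circuit, unchanged.
\<close>

lemma read_answer_shifted:
  assumes "shifted n ans (n * n) s'"
  shows "read_answer s' = extend_answer n ans"
proof -
  obtain s where s: "iarr s 0 = (\<lambda>_. 0)" "farr s 2 = ones 0 n n (\<lambda>_. 0)" "reg s 2 = n * n"
    and s': "reg s' 0 = reg (store_answer ans s) 0" "reg s' 1 = reg (store_answer ans s) 1 + n * n"
      "iarr s' = iarr (store_answer ans s)" "farr s' = farr (store_answer ans s)"
    using assms unfolding shifted_def by blast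
  show ?thesis
  proof (cases ans)
    case None
    then show ?thesis using s' by (simp add: read_answer_def store_answer_def)
  next
    case (Some c)
    have "map (read_gate s') [0..<length c + n * n] = map Const (id_entries n) @ c"
    proof (rule nth_equalityI)
      fix k assume "k < length (map (read_gate s') [0..<length c + n * n])"
      then have k: "k < length c + n * n" by simp
      have "read_gate s' k = (map Const (id_entries n) @ c) ! k"
      proof (cases "k < n * n")
        case True
        have "ones 0 n n (\<lambda>_. 0) k = id_entries n ! k"
          by (auto simp: ones_def id_entries_nth[OF True])
        then show ?thesis
          using True s s' Some
          by (simp add: read_gate_def store_answer_def overwrite_def nth_append length_id_entries)
      next
        case False
        then have l: "k - n * n < length c" "k < n * n + length c" using k by simp_all
        show ?thesis
          using s s' Some False k l
          by (cases "c ! (k - n * n)")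
            (simp_all add: read_gate_def store_answer_def overwrite_def nth_append length_id_entries)
      qed
      then show "map (read_gate s') [0..<length c + n * n] ! k = (map Const (id_entries n) @ c) ! k"
        using k by simp
    qed (simp add: length_id_entries)
    then show ?thesis using s' Some by (simp add: read_answer_def store_answer_def)
  qed
qed

text \<open>
  The three summands on the top level belong to the parts of the program: finding the address,
  writing the identity, and the call with the final loop.  The type is left open because the bound
  is needed both as a number and, applied to the indeterminate, as a polynomial.
\<close>

definition time_bound :: "'b::comm_semiring_1 \<Rightarrow> 'b" where
  "time_bound N =
    (2 + N * (2 + N * (2 + N * (1 + 2) + 2) + 2)) + ((2 + N * (3 + ((2 + N * (3 + 2)) + 2) + 2)) +
      (1 + ((1 + N + (N + 1) + 2 * ((N + 1) * N * N)) + (2 + N * N * (1 + 2)))))"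

lemma poly_time_bound: "poly (time_bound [:0, 1:]) N = time_bound N"
proof -
  have "poly [:0, 1:] N = N" by simp
  then show ?thesis
    unfolding time_bound_def by (simp only: poly_add poly_mult poly_numeral poly_1)
qed

lemma runs_reduction:
  fixes alg :: "'a::field solver"
  assumes v: "v \<in> mat_tuples n m" and w: "w \<in> mat_tuples n m"
    and N: "n \<le> N" "m \<le> N"
  shows "runs_within alg (\<lambda>s. s = initial_state n m v w) reduction
    (time_bound N)
    (\<lambda>s. read_answer s =
      extend_answer n (alg n (Suc m) (entries (v @ [1\<^sub>m n])) (entries (w @ [1\<^sub>m n]))))"
proof -
  let ?h = "\<lambda>X. overwrite 0 (entries X) (\<lambda>_. 0)"
  let ?ans = "alg n (Suc m) (entries (v @ [1\<^sub>m n])) (entries (w @ [1\<^sub>m n]))"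
  let ?ready = "\<lambda>s :: 'a state. reg s 0 = n \<and> reg s 1 = Suc m \<and> reg s 2 = n * n \<and> iarr s 0 = (\<lambda>_. 0) \<and>
    farr s 0 = ones (m * n * n) n n (?h v) \<and> farr s 1 = ones (m * n * n) n n (?h w) \<and>
    farr s 2 = ones 0 n n (\<lambda>_. 0)"
  have inc: "runs_within alg (\<lambda>s. \<exists>p q. config n m (?h v) (?h w) n (n * n) p q s) (block [IncI 1]) 1 ?ready"
    by (rule runs_within_block) (auto simp: config_def set_reg_def)
  have call: "runs_within alg ?ready Call (1 + N + (N + 1) + 2 * ((N + 1) * N * N)) (shifted n ?ans 0)"
    unfolding runs_within_def
  proof (intro allI impI)
    fix s assume s: "?ready s"
    have "solver_answer alg s = ?ans"
      using s map_ones_entries[OF v] map_ones_entries[OF w] by (simp add: solver_answer_def)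
    moreover have "call_cost s \<le> 1 + N + (N + 1) + 2 * ((N + 1) * N * N)"
      using s N by (auto simp: call_cost_def Let_def intro!: add_mono mult_le_mono simp del: mult_Suc)
    ultimately show "\<exists>t s'. exec alg Call s t s' \<and> t \<le> 1 + N + (N + 1) + 2 * ((N + 1) * N * N) \<and> shifted n ?ans 0 s'"
      using s exec.Call[of alg s] shifted_store_answer[of s n ?ans] by metis
  qed
  have count: "runs_within alg (shifted n ?ans 0) (for_loop 3 2 (block [IncI 1])) (2 + N * N * (1 + 2))
      (\<lambda>s. read_answer s = extend_answer n ?ans)"
  proof (rule runs_within_for_loop[where k = "n * n" and I = "shifted n ?ans"])
    fix i show "runs_within alg (\<lambda>s. shifted n ?ans i s \<and> reg s 3 = i) (block [IncI 1]) 1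
        (\<lambda>s. shifted n ?ans (Suc i) s \<and> reg s 3 = i)"
    proof (rule runs_within_block)
      fix s :: "'a state" assume "shifted n ?ans i s \<and> reg s 3 = i"
      then have "shifted n ?ans (Suc i) (set_reg 1 (Suc (reg s 1)) s)"
          "reg (set_reg 1 (Suc (reg s 1)) s) 3 = i"
        by (simp_all only: shifted_Suc) (simp add: set_reg_def)
      then show "shifted n ?ans (Suc i) (fold exec_instr [IncI 1] s) \<and>
          reg (fold exec_instr [IncI 1] s) 3 = i"
        by simp
    qed simp
  qed (use N in \<open>auto simp: shifted_set_reg shifted_reg_2 read_answer_shifted intro: mult_le_mono\<close>)
  have start: "config n m (?h v) (?h w) 0 0 0 0 s" if "s = initial_state n m v w" for s
    using that by (simp add: initial_state_def config_def ones_0)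
  have "runs_within alg (config n m (?h v) (?h w) 0 0 0 0) reduction
    (time_bound N)
    (\<lambda>s. read_answer s = extend_answer n ?ans)"
    unfolding reduction_def time_bound_def
    by (rule runs_within_Seq[OF runs_locate_end[OF N] runs_within_Seq[OF runs_write_identity[OF N(1)]
          runs_within_Seq[OF inc runs_within_Seq[OF call count]]]])
  then show ?thesis
    using start unfolding runs_within_def by blast
qed

theorem corollary3p4:
  shows "\<exists>red :: 'a::alg_closed_field prog.
    poly_time_reduction red matrix_invariants_problem matrix_semi_invariants_problem"
proof -
  have "\<exists>t s. exec alg reduction (initial_state n m v w) t s \<and> t \<le> poly (time_bound [:0, 1:]) (n + m) \<and>
      matrix_invariants_problem n m v w (read_answer s)"
    if alg: "solves alg matrix_semi_invariants_problem" and n: "n > 0"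
      and v: "v \<in> mat_tuples n m" and w: "w \<in> mat_tuples n m"
    for alg :: "'a solver" and n m v w
  proof -
    let ?ans = "alg n (Suc m) (entries (v @ [1\<^sub>m n])) (entries (w @ [1\<^sub>m n]))"
    have "matrix_semi_invariants_problem n (Suc m) (v @ [1\<^sub>m n]) (w @ [1\<^sub>m n]) ?ans"
      using alg n append_mat_tuples[OF v one_carrier_mat] append_mat_tuples[OF w one_carrier_mat]
      by (simp add: solves_def)
    then have "matrix_invariants_problem n m v w (extend_answer n ?ans)"
      by (rule extend_answer_correct[OF n v w])
    then show ?thesis
      using runs_reduction[OF v w le_add1 le_add2, of alg] unfolding runs_within_def poly_time_bound
      by metis
  qed
  then have "poly_time_reduction reduction
      (matrix_invariants_problem :: 'a problem) matrix_semi_invariants_problem"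
    unfolding poly_time_reduction_def by (intro exI[of _ "time_bound [:0, 1:]"]) blast
  then show ?thesis by blast
qed

end
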